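(* Let $G$ be a finite simple graph with $\delta(G)\geq 1$ and let $M(G)$ be its Mycielskian. Then $G$ belongs to Class 2 if and only if $\chi_d^t(M(G))=\chi_d^t(G)+2$.
   Context: All graphs are finite, undirected and simple. A total dominator coloring (TDC) of $G$ is a proper coloring of $G$ in which every vertex of $G$ is adjacent to every vertex of some color class; $\chi_d^t(G)$ is the minimum number of color classes in a TDC of $G$, and a $\chi_d^t$-coloring is a TDC with $\chi_d^t(G)$ colors. For a TDC $f=(V_1,\dots,V_\ell)$ (with $V_i$ the color classes), write $v\succ V_i$ if $v$ is adjacent to all vertices of $V_i$. A vertex $v$ is a private neighbor of $V_i$ with respect to $f$ if $v\succ V_i$ and $v\not\succ V_j$ for all $j\neq i$; the set of these is $pn_G(V_i;f)$. $G$ belongs to Class 1 if it has a $\chi_d^t$-coloring $f=(V_1,\dots,V_\ell)$ with $pn_G(V_i;f)=\emptyset$ for some $i$, and to Class 2 otherwise. If $V(G)=\{v_1,\dots,v_n\}$, the Mycielskian $M(G)$ has vertex set $V(G)\cup\{u_1,\dots,u_n\}\cup\{w\}$ and edge set $E(G)\cup\{u_iv_j : v_iv_j\in E(G)\}\cup\{u_iw : 1\le i\le n\}$. *)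

theory Defs
  imports "Graph_Theory.Pair_Digraph" "HOL-Library.Disjoint_Sets"
begin

text \<open>
  A finite simple graph is a \<^locale>\<open>pair_graph\<close>: an undirected edge between \<open>u\<close> and \<open>v\<close> is
  the pair of arcs \<open>(u, v)\<close>, \<open>(v, u)\<close>, so the degree of a vertex is its out-degree.
\<close>

definition min_degree :: "'a pair_pre_digraph \<Rightarrow> nat" where
  "min_degree G = Min (out_degree (with_proj G) ` pverts G)"

definition adjacent_to_all :: "'a pair_pre_digraph \<Rightarrow> 'a \<Rightarrow> 'a set \<Rightarrow> bool" where
  "adjacent_to_all G v A \<longleftrightarrow> (\<forall>x\<in>A. (v, x) \<in> parcs G)"

text \<open>
  A coloring is represented by its set of color classes. Classes are nonempty
  (this is part of \<^const>\<open>partition_on\<close>), so no vertex is vacuously adjacent to all of a class.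
\<close>

definition proper_coloring :: "'a pair_pre_digraph \<Rightarrow> 'a set set \<Rightarrow> bool" where
  "proper_coloring G P \<longleftrightarrow>
     partition_on (pverts G) P \<and> (\<forall>A\<in>P. \<forall>x\<in>A. \<forall>y\<in>A. (x, y) \<notin> parcs G)"

definition total_dominator_coloring :: "'a pair_pre_digraph \<Rightarrow> 'a set set \<Rightarrow> bool" where
  "total_dominator_coloring G P \<longleftrightarrow>
     proper_coloring G P \<and> (\<forall>v\<in>pverts G. \<exists>A\<in>P. adjacent_to_all G v A)"

text \<open>
  Meaningful only if a total dominator coloring exists, i.e. if there is no isolated vertex;
  see \<open>total_dominator_coloring_singletons\<close> below.
\<close>

definition td_chromatic_number :: "'a pair_pre_digraph \<Rightarrow> nat" where
  "td_chromatic_number G = (LEAST k. \<exists>P. total_dominator_coloring G P \<and> card P = k)"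

definition min_td_coloring :: "'a pair_pre_digraph \<Rightarrow> 'a set set \<Rightarrow> bool" where
  "min_td_coloring G P \<longleftrightarrow>
     total_dominator_coloring G P \<and> card P = td_chromatic_number G"

definition private_neighbors :: "'a pair_pre_digraph \<Rightarrow> 'a set set \<Rightarrow> 'a set \<Rightarrow> 'a set" where
  "private_neighbors G P A =
     {v \<in> pverts G. adjacent_to_all G v A \<and> (\<forall>B\<in>P. B \<noteq> A \<longrightarrow> \<not> adjacent_to_all G v B)}"

definition class_1 :: "'a pair_pre_digraph \<Rightarrow> bool" where
  "class_1 G \<longleftrightarrow> (\<exists>P. min_td_coloring G P \<and> (\<exists>A\<in>P. private_neighbors G P A = {}))"

definition class_2 :: "'a pair_pre_digraph \<Rightarrow> bool" where
  "class_2 G \<longleftrightarrow> \<not> class_1 G"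

datatype 'a mycielski_vertex = Orig 'a | Copy 'a | Apex

definition mycielskian :: "'a pair_pre_digraph \<Rightarrow> 'a mycielski_vertex pair_pre_digraph" where
  "mycielskian G =
     \<lparr> pverts = Orig ` pverts G \<union> Copy ` pverts G \<union> {Apex},
       parcs = {(Orig x, Orig y) | x y. (x, y) \<in> parcs G}
             \<union> {(Copy x, Orig y) | x y. (x, y) \<in> parcs G}
             \<union> {(Orig x, Copy y) | x y. (x, y) \<in> parcs G}
             \<union> {(Copy x, Apex) | x. x \<in> pverts G}
             \<union> {(Apex, Copy x) | x. x \<in> pverts G} \<rparr>"

lemma pair_graph_mycielskian:
  assumes "pair_graph G"
  shows "pair_graph (mycielskian G)"
proof -
  interpret G: pair_graph G by fact
  have V: "finite (pverts (mycielskian G))"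
    by (simp add: mycielskian_def G.pair_finite_verts)
  have sub: "parcs (mycielskian G) \<subseteq> pverts (mycielskian G) \<times> pverts (mycielskian G)"
    by (auto simp: mycielskian_def dest: G.wellformed')
  show ?thesis
  proof
    show "finite (parcs (mycielskian G))"
      using finite_subset[OF sub] V by blast
    show "symmetric (with_proj (mycielskian G))"
      by (auto simp: symmetric_def sym_def mycielskian_def dest: G.arcs_symmetric)
    show "fst e \<noteq> snd e" if "e \<in> parcs (mycielskian G)" for e
      using that by (auto simp: mycielskian_def dest: G.no_loops')
  qed (use V sub in auto)
qed

lemma total_dominator_coloring_singletons:
  assumes "pair_graph G" "pverts G \<noteq> {}" "min_degree G \<ge> 1"
  shows "total_dominator_coloring G ((\<lambda>v. {v}) ` pverts G)"
proof -
  interpret G: pair_graph G by fact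
  have "\<exists>x\<in>pverts G. (v, x) \<in> parcs G" if v: "v \<in> pverts G" for v
  proof -
    have "out_degree (with_proj G) v \<ge> 1"
      using assms(2,3) v G.pair_finite_verts by (simp add: min_degree_def Min_ge_iff)
    then have "out_arcs (with_proj G) v \<noteq> {}"
      by (auto simp: out_degree_def)
    then show ?thesis
      by (auto simp: out_arcs_def dest: G.wellformed')
  qed
  moreover have "partition_on (pverts G) ((\<lambda>v. {v}) ` pverts G)"
    by (auto simp: partition_on_def disjoint_def)
  ultimately show ?thesis
    by (auto simp: total_dominator_coloring_def proper_coloring_def adjacent_to_all_def
        dest: G.no_loops')
qed

end

theory Submission
  imports Defs
begin

text \<open>
  Restrict a coloring of \<open>M(G)\<close> with at most \<open>\<chi> + 1\<close> classes to \<open>G\<close>, where \<open>\<chi>\<close> is the total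
  dominator chromatic number of \<open>G\<close>. Some class consists of copies only, because the apex
  dominates one.

  If the class of the apex meets \<open>V(G)\<close>, the restriction has at most \<open>\<chi>\<close> classes. The copies only
  dominate classes free of copies, so a class containing both kinds of vertices has no private
  neighbor after restriction. If there is no such class, all copies form one class, which no
  original vertex dominates; so the class of the apex has no private neighbor.

  If the apex is alone in its class, each class consisting of copies only is traded for the singleton
  of the original of one of its members. A class that loses a vertex \<open>x\<close> in this way has no
  private neighbor: whoever dominated it before dominates the singleton of \<open>x\<close> now.
\<close>

section \<open>Vertices and adjacency of the Mycielskian\<close>

lemma parcs_mycielskian [simp]:
  "(Orig x, Orig y) \<in> parcs (mycielskian G) \<longleftrightarrow> (x, y) \<in> parcs G"
  "(Copy x, Orig y) \<in> parcs (mycielskian G) \<longleftrightarrow> (x, y) \<in> parcs G"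
  "(Orig x, Copy y) \<in> parcs (mycielskian G) \<longleftrightarrow> (x, y) \<in> parcs G"
  "(Copy x, Copy y) \<notin> parcs (mycielskian G)"
  "(Copy x, Apex) \<in> parcs (mycielskian G) \<longleftrightarrow> x \<in> pverts G"
  "(Apex, Copy x) \<in> parcs (mycielskian G) \<longleftrightarrow> x \<in> pverts G"
  "(Orig x, Apex) \<notin> parcs (mycielskian G)"
  "(Apex, Orig x) \<notin> parcs (mycielskian G)"
  "(Apex, Apex) \<notin> parcs (mycielskian G)"
  by (auto simp: mycielskian_def)

lemma pverts_mycielskian:
  "pverts (mycielskian G) = Orig ` pverts G \<union> Copy ` pverts G \<union> {Apex}"
  by (simp add: mycielskian_def)

lemma in_pverts_mycielskian [simp]:
  "Orig x \<in> pverts (mycielskian G) \<longleftrightarrow> x \<in> pverts G"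
  "Copy x \<in> pverts (mycielskian G) \<longleftrightarrow> x \<in> pverts G"
  "Apex \<in> pverts (mycielskian G)"
  by (auto simp: mycielskian_def)

section \<open>Minimum colorings and Class 1\<close>

lemma td_chromatic_number_le:
  "total_dominator_coloring G P \<Longrightarrow> td_chromatic_number G \<le> card P"
  unfolding td_chromatic_number_def by (rule Least_le) blast

lemma min_td_coloring_exists:
  assumes "total_dominator_coloring G P"
  obtains Q where "min_td_coloring G Q"
proof -
  have "\<exists>Q. total_dominator_coloring G Q \<and> card Q = td_chromatic_number G"
    unfolding td_chromatic_number_def by (rule LeastI_ex) (use assms in blast)
  then show ?thesis
    using that by (auto simp: min_td_coloring_def)
qed

text \<open>The condition \<open>dom\<close> does double duty: it makes \<open>P\<close> a total
  dominator coloring, hence a minimum one by the cardinality bound, and it leaves \<open>A\<close>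
  without private neighbors.\<close>

lemma class_1I:
  assumes P: "proper_coloring G P" "card P \<le> td_chromatic_number G" and A: "A \<in> P"
    and dom: "\<And>v. v \<in> pverts G \<Longrightarrow> \<exists>B\<in>P. B \<noteq> A \<and> adjacent_to_all G v B"
  shows "class_1 G"
proof -
  have "total_dominator_coloring G P"
    using P dom by (auto simp: total_dominator_coloring_def)
  then have "min_td_coloring G P"
    using td_chromatic_number_le[of G P] P by (auto simp: min_td_coloring_def)
  moreover have "private_neighbors G P A = {}"
    using dom by (auto simp: private_neighbors_def)
  ultimately show ?thesis
    using A by (auto simp: class_1_def)
qed

text \<open>Every vertex dominates some class of a total dominator coloring; if that class could
  only be \<open>A\<close>, the vertex would be a private neighbor of \<open>A\<close>.\<close>

lemma class_1E:
  assumes "class_1 G"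
  obtains P A where "min_td_coloring G P" "A \<in> P"
    "\<And>v. v \<in> pverts G \<Longrightarrow> \<exists>B\<in>P. B \<noteq> A \<and> adjacent_to_all G v B"
proof -
  obtain P A where PA: "min_td_coloring G P" "A \<in> P" "private_neighbors G P A = {}"
    using assms by (auto simp: class_1_def)
  have "\<exists>B\<in>P. B \<noteq> A \<and> adjacent_to_all G v B" if v: "v \<in> pverts G" for v
  proof -
    obtain B where "B \<in> P" "adjacent_to_all G v B"
      using PA(1) v by (auto simp: min_td_coloring_def total_dominator_coloring_def)
    then show ?thesis
      using PA(3) v by (auto simp: private_neighbors_def)
  qed
  with PA show ?thesis
    using that by blast
qed

section \<open>Proper colorings: restriction and refinement\<close>

lemma proper_coloring_unique:
  "\<lbrakk>proper_coloring G P; A \<in> P; B \<in> P; x \<in> A; x \<in> B\<rbrakk> \<Longrightarrow> A = B"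
  unfolding proper_coloring_def partition_on_def disjoint_def by blast

lemma proper_coloring_cover:
  "\<lbrakk>proper_coloring G P; x \<in> pverts G\<rbrakk> \<Longrightarrow> \<exists>A\<in>P. x \<in> A"
  unfolding proper_coloring_def partition_on_def by blast

lemma proper_coloringI:
  assumes "\<And>A. A \<in> P \<Longrightarrow> A \<noteq> {}" "\<And>A. A \<in> P \<Longrightarrow> A \<subseteq> pverts G"
    and "\<And>x. x \<in> pverts G \<Longrightarrow> \<exists>A\<in>P. x \<in> A"
    and "\<And>A B x. \<lbrakk>A \<in> P; B \<in> P; x \<in> A; x \<in> B\<rbrakk> \<Longrightarrow> A = B"
    and "\<And>A x y. \<lbrakk>A \<in> P; x \<in> A; y \<in> A\<rbrakk> \<Longrightarrow> (x, y) \<notin> parcs G"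
  shows "proper_coloring G P"
  unfolding proper_coloring_def partition_on_def
proof (intro conjI ballI)
  show "\<Union>P = pverts G"
    using assms(2,3) by (auto dest: subsetD)
  show "disjoint P"
    by (rule disjointI) (use assms(4) in blast)
  show "{} \<notin> P"
    using assms(1)[of "{}"] by blast
qed (rule assms(5))

lemma proper_coloring_finite:
  assumes "pair_graph G" "proper_coloring G P"
  shows "finite P"
proof -
  interpret pair_graph G by fact
  show ?thesis
    using assms(2) finite_elements[OF pair_finite_verts] by (simp add: proper_coloring_def)
qed

text \<open>The original vertices induce \<open>G\<close> in its Mycielskian, so traces of classes
  stay independent. A class without original vertices has an empty trace, which is dropped.\<close>

lemma proper_coloring_restrict:
  assumes "proper_coloring (mycielskian G) Q"
  shows "proper_coloring G ((\<lambda>B. Orig -` B) ` Q - {{}})"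
proof (rule proper_coloringI)
  fix A assume "A \<in> (\<lambda>B. Orig -` B) ` Q - {{}}"
  then obtain B where B: "B \<in> Q" "A = Orig -` B"
    by blast
  have "\<Union>Q = pverts (mycielskian G)"
    using assms by (simp add: proper_coloring_def partition_on_def)
  with B(1) have "B \<subseteq> pverts (mycielskian G)"
    by blast
  then show "A \<subseteq> pverts G"
    by (auto simp: B(2) pverts_mycielskian)
next
  fix x assume "x \<in> pverts G"
  then obtain B where "B \<in> Q" "Orig x \<in> B"
    using proper_coloring_cover[OF assms, of "Orig x"] by auto
  then show "\<exists>A\<in>(\<lambda>B. Orig -` B) ` Q - {{}}. x \<in> A"
    by (intro bexI[of _ "Orig -` B"]) auto
next
  fix A B x
  assume "A \<in> (\<lambda>B. Orig -` B) ` Q - {{}}" "B \<in> (\<lambda>B. Orig -` B) ` Q - {{}}" "x \<in> A" "x \<in> B"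
  then obtain A' B' where "A' \<in> Q" "A = Orig -` A'" "B' \<in> Q" "B = Orig -` B'" "Orig x \<in> A'" "Orig x \<in> B'"
    by blast
  then show "A = B"
    using proper_coloring_unique[OF assms] by metis
next
  fix A x y
  assume A: "A \<in> (\<lambda>B. Orig -` B) ` Q - {{}}" "x \<in> A" "y \<in> A"
  have "\<forall>B\<in>Q. \<forall>x\<in>B. \<forall>y\<in>B. (x, y) \<notin> parcs (mycielskian G)"
    using assms by (simp add: proper_coloring_def)
  moreover obtain B where "B \<in> Q" "Orig x \<in> B" "Orig y \<in> B"
    using A by blast
  ultimately have "(Orig x, Orig y) \<notin> parcs (mycielskian G)"
    by blast
  then show "(x, y) \<notin> parcs G"
    by simp
qed auto

text \<open>Refining a proper coloring keeps it proper. This splits off the original vertices that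
  stand in for classes of copies.\<close>

lemma proper_coloring_isolate:
  assumes P: "proper_coloring G P" and S: "S \<subseteq> pverts G"
  shows "proper_coloring G ((\<lambda>x. {x}) ` S \<union> ((\<lambda>A. A - S) ` P - {{}}))"
proof (rule proper_coloringI)
  have un: "\<Union>P = pverts G"
    using P by (auto simp: proper_coloring_def partition_on_def)
  show "A \<subseteq> pverts G" if "A \<in> (\<lambda>x. {x}) ` S \<union> ((\<lambda>A. A - S) ` P - {{}})" for A
  proof -
    have "A \<subseteq> \<Union>P \<union> S"
      using that by auto
    with un S show ?thesis
      by (simp add: Un_absorb2)
  qed
  show "\<exists>A\<in>(\<lambda>x. {x}) ` S \<union> ((\<lambda>A. A - S) ` P - {{}}). x \<in> A" if "x \<in> pverts G" for x
  proof (cases "x \<in> S")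
    case False
    obtain A where "A \<in> P" "x \<in> A"
      using proper_coloring_cover[OF P \<open>x \<in> pverts G\<close>] by blast
    with False show ?thesis
      by (intro bexI[of _ "A - S"]) auto
  qed auto
next
  fix A B x
  assume "A \<in> (\<lambda>x. {x}) ` S \<union> ((\<lambda>A. A - S) ` P - {{}})"
    "B \<in> (\<lambda>x. {x}) ` S \<union> ((\<lambda>A. A - S) ` P - {{}})" "x \<in> A" "x \<in> B"
  \<comment> \<open>For fixed \<open>x\<close>, the map \<open>h\<close> recovers a new class around
    \<open>x\<close> from the class of \<open>P\<close> behind it; if \<open>x\<close> lies in
    \<open>S\<close>, its argument is irrelevant.\<close>
  moreover define h where "h A = (if x \<in> S then {x} else A - S)" for A
  ultimately obtain A' B' where "x \<in> S \<or> A' \<in> P \<and> x \<in> A' \<and> B' \<in> P \<and> x \<in> B'" "A = h A'" "B = h B'"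
    by (cases "x \<in> S") auto
  then show "A = B"
    using proper_coloring_unique[OF P, of A' B' x] by (cases "x \<in> S") (auto simp: h_def)
next
  fix A x y
  assume A: "A \<in> (\<lambda>x. {x}) ` S \<union> ((\<lambda>A. A - S) ` P - {{}})" "x \<in> A" "y \<in> A"
  have P': "\<forall>A\<in>P. \<forall>x\<in>A. \<forall>y\<in>A. (x, y) \<notin> parcs G"
    using P by (simp add: proper_coloring_def)
  \<comment> \<open>For a singleton class \<open>x = y\<close>, and properness of the class of
    \<open>P\<close> around \<open>x\<close> excludes a loop there.\<close>
  obtain A' where "A' \<in> P" "x \<in> A'" "x = y \<or> y \<in> A'"
  proof (cases "A \<in> (\<lambda>x. {x}) ` S")
    case True
    with A S have "x = y" "x \<in> pverts G" by auto
    then show ?thesis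
      using that proper_coloring_cover[OF P] by metis
  next
    case False
    with A obtain A' where "A' \<in> P" "A = A' - S"
      by auto
    with A show ?thesis
      using that by blast
  qed
  with P' show "(x, y) \<notin> parcs G"
    by blast
qed auto

section \<open>Upper bounds for the Mycielskian\<close>

text \<open>The case \<open>A = {}\<close> removes no class and covers colorings in which every class may be needed for domination.\<close>

lemma mycielskian_coloring:
  assumes G: "pair_graph G" "pverts G \<noteq> {}" and P: "proper_coloring G P"
    and A: "A \<in> insert {} P"
    and dom: "\<And>v. v \<in> pverts G \<Longrightarrow> \<exists>B\<in>P. B \<noteq> A \<and> adjacent_to_all G v B"
  obtains Q where "total_dominator_coloring (mycielskian G) Q" "card Q \<le> card (P - {A}) + 2"
proof
  \<comment> \<open>The apex joins \<open>A\<close> and dominates the single class of all copies. An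
    original vertex and its copy both dominate the lift of a class other than
    \<open>A\<close>.\<close>
  define Q where "Q = insert (Copy ` pverts G) (insert (insert Apex (Orig ` A)) ((`) Orig ` (P - {A})))"
  have P': "{} \<notin> P" "\<Union>P = pverts G" "\<forall>A\<in>P. \<forall>x\<in>A. \<forall>y\<in>A. (x, y) \<notin> parcs G"
    using P by (auto simp: proper_coloring_def partition_on_def)
  have disj: "\<And>B x. B \<in> P \<Longrightarrow> x \<in> A \<Longrightarrow> x \<in> B \<Longrightarrow> A = B"
    using A proper_coloring_unique[OF P] by blast
  have "proper_coloring (mycielskian G) Q"
  proof (rule proper_coloringI)
    show "B \<noteq> {}" if "B \<in> Q" for B
      using that P' G(2) by (auto simp: Q_def)
    show "B \<subseteq> pverts (mycielskian G)" if "B \<in> Q" for B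
      using that P'(2) A by (auto simp: Q_def pverts_mycielskian)
    show "\<exists>B\<in>Q. x \<in> B" if "x \<in> pverts (mycielskian G)" for x
    proof (cases x)
      case (Orig y)
      with that obtain B where "B \<in> P" "y \<in> B"
        using P'(2) by (auto simp: pverts_mycielskian)
      then show ?thesis
        using Orig by (cases "B = A") (auto simp: Q_def)
    next
      case (Copy y)
      with that have "x \<in> Copy ` pverts G"
        by simp
      then show ?thesis
        unfolding Q_def by blast
    qed (simp add: Q_def)
  next
    fix B C x
    assume "B \<in> Q" "C \<in> Q" "x \<in> B" "x \<in> C"
    then show "B = C"
    proof (cases x)
      case (Orig y)
      \<comment> \<open>\<open>h\<close> turns a class of \<open>P\<close>, or the empty
        \<open>A\<close>, into its counterpart in \<open>Q\<close>, so classes of \<open>Q\<close>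
        sharing an original vertex come from the same class.\<close>
      define h where "h B = (if B = A then insert Apex (Orig ` A) else Orig ` B)" for B
      have "\<exists>B'\<in>insert A P. y \<in> B' \<and> D = h B'" if "D \<in> Q" "x \<in> D" for D
      proof -
        from that Orig consider "D = insert Apex (Orig ` A)" "y \<in> A"
          | B' where "B' \<in> P" "B' \<noteq> A" "D = Orig ` B'" "y \<in> B'"
          unfolding Q_def by blast
        then show ?thesis
        proof cases
          case 1
          then show ?thesis
            by (simp add: h_def)
        next
          case (2 B')
          then show ?thesis
            by (intro bexI[of _ B']) (simp_all add: h_def)
        qed
      qed
      then obtain B' C' where "B' \<in> insert A P" "y \<in> B'" "B = h B'" "C' \<in> insert A P" "y \<in> C'" "C = h C'"
        using \<open>B \<in> Q\<close> \<open>C \<in> Q\<close> \<open>x \<in> B\<close> \<open>x \<in> C\<close> by meson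
      moreover from this have "B' = C'"
        using disj proper_coloring_unique[OF P] by (metis insertE)
      ultimately show ?thesis
        by simp
    qed (use \<open>B \<in> Q\<close> \<open>C \<in> Q\<close> \<open>x \<in> B\<close> \<open>x \<in> C\<close> in \<open>auto simp: Q_def\<close>)
  next
    fix B x y
    assume "B \<in> Q" "x \<in> B" "y \<in> B"
    then show "(x, y) \<notin> parcs (mycielskian G)"
      using P'(3) A by (auto simp: Q_def)
  qed
  moreover have "\<exists>B\<in>Q. adjacent_to_all (mycielskian G) x B" if "x \<in> pverts (mycielskian G)" for x
  proof (cases "x = Apex")
    case True
    then show ?thesis
      by (auto simp: Q_def adjacent_to_all_def)
  next
    case False
    with that obtain v where v: "v \<in> pverts G" "x = Orig v \<or> x = Copy v"
      by (auto simp: pverts_mycielskian)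
    with dom obtain B where "B \<in> P" "B \<noteq> A" "adjacent_to_all G v B"
      by blast
    with v show ?thesis
      by (intro bexI[of _ "Orig ` B"]) (auto simp: Q_def adjacent_to_all_def)
  qed
  ultimately show "total_dominator_coloring (mycielskian G) Q"
    by (simp add: total_dominator_coloring_def)
  have fin: "finite (P - {A})"
    using proper_coloring_finite[OF G(1) P] by simp
  have "card Q \<le> Suc (Suc (card ((`) Orig ` (P - {A}))))"
    using fin by (simp add: Q_def card_insert_if)
  also have "card ((`) Orig ` (P - {A})) \<le> card (P - {A})"
    using fin by (rule card_image_le)
  finally show "card Q \<le> card (P - {A}) + 2"
    by simp
qed

section \<open>Lower bound for the Mycielskian\<close>

text \<open>In contrapositive form, Class 2 forces two extra colors. Each case builds a coloring of
  \<open>G\<close> to which \<open>class_1I\<close> applies.\<close>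

lemma class_1_if_mycielskian_coloring:
  assumes G: "pair_graph G" and Q: "total_dominator_coloring (mycielskian G) Q"
    and card: "card Q \<le> td_chromatic_number G + 1"
  shows "class_1 G"
proof -
  have no_loop: "(x, x) \<notin> parcs G" for x
  proof -
    interpret pair_graph G by fact
    show ?thesis
      using no_loops' by blast
  qed
  define orig :: "'a mycielski_vertex set \<Rightarrow> 'a set" where "orig B = Orig -` B" for B
  have in_orig [simp]: "x \<in> orig B \<longleftrightarrow> Orig x \<in> B" for x B
    by (simp add: orig_def)
  define R where "R = orig ` Q - {{}}"
  have pQ: "proper_coloring (mycielskian G) Q"
    using Q by (simp add: total_dominator_coloring_def)
  note uniq = proper_coloring_unique[OF pQ]
  have unQ: "\<Union>Q = pverts (mycielskian G)" and neQ: "{} \<notin> Q"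
    using pQ by (auto simp: proper_coloring_def partition_on_def)
  have domQ: "\<And>x. x \<in> pverts (mycielskian G) \<Longrightarrow> \<exists>B\<in>Q. adjacent_to_all (mycielskian G) x B"
    using Q by (simp add: total_dominator_coloring_def)
  have finQ: "finite Q"
    using proper_coloring_finite[OF pair_graph_mycielskian[OF G] pQ] .
  have pR: "proper_coloring G R"
    unfolding R_def orig_def by (rule proper_coloring_restrict[OF pQ])
  obtain W where W: "W \<in> Q" "Apex \<in> W"
    using proper_coloring_cover[OF pQ, of Apex] by auto
  obtain C where C: "C \<in> Q" "adjacent_to_all (mycielskian G) Apex C"
    using domQ[of Apex] by auto
  have C_copies: "\<exists>x\<in>pverts G. y = Copy x" if "y \<in> C" for y
    using that C(2) by (cases y) (auto simp: adjacent_to_all_def)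
  \<comment> \<open>Such a class has neither original vertices nor the apex, which lies in
    \<open>W\<close>.\<close>
  have copy: "\<exists>x\<in>pverts G. Copy x \<in> B" if B: "B \<in> Q" "orig B = {}" "B \<noteq> W" for B
  proof -
    obtain y where y: "y \<in> B"
      using B(1) neQ by (metis all_not_in_conv)
    moreover have "y \<in> pverts (mycielskian G)"
      using y B(1) unQ by blast
    ultimately show ?thesis
      using B uniq[OF B(1) W(1), of Apex] W(2)
      by (cases y) (auto simp: pverts_mycielskian simp del: vimage_eq simp flip: in_orig)
  qed
  have dom_orig: "\<exists>B\<in>Q. B \<noteq> W \<and> adjacent_to_all (mycielskian G) (Orig v) B"
    if v: "v \<in> pverts G" for v
  proof -
    obtain B where B: "B \<in> Q" "adjacent_to_all (mycielskian G) (Orig v) B"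
      using domQ[of "Orig v"] v by auto
    have "(Orig v, Apex) \<notin> parcs (mycielskian G)"
      by simp
    with B(2) W(2) have "B \<noteq> W"
      unfolding adjacent_to_all_def by metis
    with B show ?thesis
      by (intro bexI[of _ B] conjI)
  qed
  \<comment> \<open>\<open>Orig v\<close> and \<open>Copy v\<close> have the same original
    neighbors. The trace \<open>orig B\<close> may be empty, so nonemptiness has to be shown
    separately wherever it matters.\<close>
  have adj_orig: "adjacent_to_all G v (orig B)"
    if "adjacent_to_all (mycielskian G) (Orig v) B \<or> adjacent_to_all (mycielskian G) (Copy v) B" for v B
    unfolding adjacent_to_all_def
  proof
    fix x assume "x \<in> orig B"
    with that have "(Orig v, Orig x) \<in> parcs (mycielskian G) \<or> (Copy v, Orig x) \<in> parcs (mycielskian G)"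
      unfolding adjacent_to_all_def in_orig by blast
    then show "(v, x) \<in> parcs G"
      by simp
  qed
  have orig_eq: "B = B'" if "B \<in> Q" "B' \<in> Q" "orig B = orig B'" "orig B \<noteq> {}" for B B'
    using that uniq by (metis all_not_in_conv in_orig)
  show ?thesis
  proof (cases "orig W = {}")
    case True
    have ex: "\<forall>B\<in>{B \<in> Q. orig B = {} \<and> B \<noteq> W}. \<exists>x. x \<in> pverts G \<and> Copy x \<in> B"
      using copy by blast
    obtain rep where rep: "\<And>B. \<lbrakk>B \<in> Q; orig B = {}; B \<noteq> W\<rbrakk> \<Longrightarrow> rep B \<in> pverts G \<and> Copy (rep B) \<in> B"
      using bchoice[OF ex] by blast
    define S where "S = rep ` {B \<in> Q. orig B = {} \<and> B \<noteq> W}"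
    \<comment> \<open>\<open>f\<close> sends each class of \<open>Q\<close> other than
      \<open>W\<close> to its replacement in \<open>G\<close>. Being an image, \<open>P\<close> has
      at most \<open>card Q - 1\<close> classes.\<close>
    define f where "f B = (if orig B = {} then {rep B} else orig B - S)" for B
    define P where "P = f ` (Q - {W}) - {{}}"
    have "P = (\<lambda>x. {x}) ` S \<union> ((\<lambda>A. A - S) ` R - {{}})"
    proof (intro equalityI subsetI)
      fix A assume "A \<in> P"
      then obtain B where "B \<in> Q" "B \<noteq> W" "A = f B" "A \<noteq> {}"
        by (auto simp: P_def)
      then show "A \<in> (\<lambda>x. {x}) ` S \<union> ((\<lambda>A. A - S) ` R - {{}})"
        by (cases "orig B = {}") (auto simp: f_def S_def R_def)
    next
      fix A assume "A \<in> (\<lambda>x. {x}) ` S \<union> ((\<lambda>A. A - S) ` R - {{}})"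
      then consider B where "B \<in> Q" "orig B = {}" "B \<noteq> W" "A = {rep B}"
        | B where "B \<in> Q" "orig B \<noteq> {}" "A = orig B - S" "A \<noteq> {}"
        unfolding S_def R_def by blast
      then show "A \<in> P"
      proof cases
        case 1
        then have "A = f B" by (simp add: f_def)
        with 1 show ?thesis by (auto simp: P_def)
      next
        case 2
        then have "A = f B" "B \<noteq> W" using True by (auto simp: f_def)
        with 2 show ?thesis by (auto simp: P_def)
      qed
    qed
    moreover have "S \<subseteq> pverts G"
      using rep by (auto simp: S_def)
    ultimately have pP: "proper_coloring G P" and SP: "\<And>x. x \<in> S \<Longrightarrow> {x} \<in> P"
      using proper_coloring_isolate[OF pR] by auto
    have C': "orig C = {}" "C \<noteq> W"
      using C_copies W(2) by (auto simp: orig_def)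
    \<comment> \<open>\<open>C\<close> guarantees that \<open>S\<close> is nonempty. The class
      \<open>D\<close> around \<open>Orig x\<close> loses \<open>x\<close>, so \<open>f D\<close> is
      the candidate without private neighbors.\<close>
    define x where "x = rep C"
    have x: "x \<in> S" "x \<in> pverts G"
      using C' C(1) rep by (auto simp: x_def S_def)
    obtain D where D: "D \<in> Q" "Orig x \<in> D"
      using proper_coloring_cover[OF pQ, of "Orig x"] x(2) by auto
    have D': "orig D \<noteq> {}" "D \<noteq> W"
      using D True by (auto simp flip: in_orig)
    have fD: "f D = orig D - S"
      using D' by (simp add: f_def)
    have dom: "\<exists>A\<in>P. A \<noteq> f D \<and> adjacent_to_all G v A" if v: "v \<in> pverts G" for v
    proof -
      obtain B where B: "B \<in> Q" "B \<noteq> W" "adjacent_to_all (mycielskian G) (Orig v) B"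
        using dom_orig v by blast
      have sing: ?thesis if "y \<in> S" "(v, y) \<in> parcs G" for y
        using that SP fD by (intro bexI[of _ "{y}"]) (auto simp: adjacent_to_all_def)
      \<comment> \<open>If \<open>B\<close> has only copies, \<open>v\<close> is adjacent to its
        representative; if the trace of \<open>B\<close> meets \<open>S\<close>, to a common
        element. Otherwise \<open>B\<close> survives unchanged and differs from \<open>D\<close>,
        whose trace contains \<open>x\<close>.\<close>
      consider "orig B = {}" | y where "y \<in> orig B" "y \<in> S" | "orig B \<noteq> {}" "orig B \<inter> S = {}"
        by blast
      then show ?thesis
      proof cases
        case 1
        then have "rep B \<in> S" "(v, rep B) \<in> parcs G"
          using rep[of B] B by (auto simp: S_def adjacent_to_all_def)
        then show ?thesis by (rule sing)
      next
        case 2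
        then have "(v, y) \<in> parcs G"
          using adj_orig B(3) by (auto simp: adjacent_to_all_def)
        with 2 show ?thesis using sing by blast
      next
        case 3
        then have f: "f B = orig B" "B \<noteq> D"
          using D x by (auto simp: f_def simp flip: in_orig)
        obtain y where y: "y \<in> orig B" "y \<notin> orig D"
          using 3 f(2) uniq[OF B(1) D(1)] by (metis all_not_in_conv in_orig)
        then have "f B \<noteq> f D"
          using f(1) fD by blast
        with f 3 B show ?thesis
          using adj_orig by (intro bexI[of _ "f B"]) (auto simp: P_def)
      qed
    qed
    have "total_dominator_coloring G P"
      using pP dom by (auto simp: total_dominator_coloring_def)
    then have low: "td_chromatic_number G \<le> card P"
      by (rule td_chromatic_number_le)
    have le: "card P \<le> card X" if "X \<subseteq> Q" "P \<subseteq> f ` X" for X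
      using that finQ by (meson surj_card_le finite_subset)
    \<comment> \<open>An empty \<open>f D\<close> would leave a total dominator coloring with fewer
      than \<open>td_chromatic_number G\<close> classes.\<close>
    have "f D \<noteq> {}"
    proof
      assume "f D = {}"
      then have "P \<subseteq> f ` (Q - {W, D})"
        by (auto simp: P_def)
      then have "card P \<le> card (Q - {W, D})"
        by (intro le) auto
      also have "\<dots> = card Q - 2"
        using W D D' by (subst card_Diff_subset) auto
      finally show False
        \<comment> \<open>\<open>card_mono\<close> gives \<open>card Q\<close> at least 2, so the
          truncated subtraction is exact.\<close>
        using low card card_mono[OF finQ, of "{W, D}"] W D D' by auto
    qed
    then have "f D \<in> P"
      using D D' by (auto simp: P_def)
    moreover have "card P \<le> card (Q - {W})"
      by (rule le) (auto simp: P_def)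
    then have "card P \<le> td_chromatic_number G"
      using card W finQ by simp
    ultimately show ?thesis
      using class_1I[OF pP] dom by blast
  next
    case False
    \<comment> \<open>Copies are pairwise nonadjacent, so \<open>Copy v\<close> dominates only
      classes free of copies. In this case \<open>W\<close> has a nonempty trace too, so the trace
      of such a class cannot be empty.\<close>
    have dom_pure: "\<exists>B\<in>Q. orig B \<noteq> {} \<and> (\<forall>y. Copy y \<notin> B) \<and> adjacent_to_all G v (orig B)"
      if v: "v \<in> pverts G" for v
    proof -
      obtain B where B: "B \<in> Q" "adjacent_to_all (mycielskian G) (Copy v) B"
        using domQ[of "Copy v"] v by auto
      then have "\<forall>y. Copy y \<notin> B"
        by (auto simp: adjacent_to_all_def)
      moreover from this have "orig B \<noteq> {}"
        using copy[OF B(1)] False by blast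
      ultimately show ?thesis
        using B adj_orig by blast
    qed
    have RI: "orig B \<in> R" if "B \<in> Q" "orig B \<noteq> {}" for B
      using that by (auto simp: R_def)
    have "total_dominator_coloring G R"
      using pR dom_pure RI unfolding total_dominator_coloring_def by blast
    then have low: "td_chromatic_number G \<le> card R"
      by (rule td_chromatic_number_le)
    have le: "card R \<le> card X" if "X \<subseteq> Q" "R \<subseteq> orig ` X" for X
      using that finQ by (meson surj_card_le finite_subset)
    have C': "orig C = {}"
      using C_copies by (auto simp: orig_def)
    have "R \<subseteq> orig ` (Q - {C})"
      using C' by (auto simp: R_def)
    then have "card R \<le> card (Q - {C})"
      by (intro le) auto
    then have up: "card R \<le> td_chromatic_number G"
      using card C finQ by simp
    show ?thesis
    proof (cases "\<exists>D\<in>Q. orig D \<noteq> {} \<and> (\<exists>y. Copy y \<in> D)")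
      case True
      then obtain D y where D: "D \<in> Q" "orig D \<noteq> {}" "Copy y \<in> D"
        by blast
      have "\<exists>A\<in>R. A \<noteq> orig D \<and> adjacent_to_all G v A" if v: "v \<in> pverts G" for v
        \<comment> \<open>The class from \<open>dom_pure\<close> has no copies and hence is not
          \<open>D\<close>; by \<open>orig_eq\<close> the traces differ as well.\<close>
        using dom_pure[OF v] RI orig_eq D by metis
      then show ?thesis
        using class_1I[OF pR up RI] D by blast
    next
      case no_mixed: False
      have "\<exists>A\<in>R. A \<noteq> orig W \<and> adjacent_to_all G v A" if v: "v \<in> pverts G" for v
      proof -
        obtain B where B: "B \<in> Q" "B \<noteq> W" "adjacent_to_all (mycielskian G) (Orig v) B"
          using dom_orig v by blast
        \<comment> \<open>Otherwise \<open>B\<close> and the class \<open>E\<close> of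
          \<open>Copy v\<close> both have empty traces. They are distinct because
          \<open>Orig v\<close> is not adjacent to \<open>Copy v\<close>, so \<open>R\<close> would
          have too few classes.\<close>
        have "orig B \<noteq> {}"
        proof
          assume B': "orig B = {}"
          obtain E where E: "E \<in> Q" "Copy v \<in> E"
            using proper_coloring_cover[OF pQ, of "Copy v"] v by auto
          then have E': "orig E = {}"
            using no_mixed by blast
          have "B \<noteq> E"
            using B(3) E(2) no_loop by (auto simp: adjacent_to_all_def)
          have "R \<subseteq> orig ` (Q - {B, E})"
            using B' E' by (auto simp: R_def)
          then have "card R \<le> card (Q - {B, E})"
            by (intro le) auto
          also have "\<dots> = card Q - 2"
            using B E \<open>B \<noteq> E\<close> by (subst card_Diff_subset) auto
          finally show False
            using low card card_mono[OF finQ, of "{B, E}"] B E \<open>B \<noteq> E\<close> by auto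
        qed
        then show ?thesis
          using RI[OF B(1)] orig_eq[OF B(1) W(1)] B adj_orig by blast
      qed
      then show ?thesis
        using class_1I[OF pR up RI] W False by blast
    qed
  qed
qed

section \<open>The characterization of Class 2\<close>

theorem theorem2p4:
  fixes G :: "'a pair_pre_digraph"
  assumes "pair_graph G"
    and "pverts G \<noteq> {}"
    and "min_degree G \<ge> 1"
  shows "class_2 G \<longleftrightarrow>
         td_chromatic_number (mycielskian G) = td_chromatic_number G + 2"
proof -
  obtain P where P: "min_td_coloring G P"
    using min_td_coloring_exists total_dominator_coloring_singletons[OF assms] by blast
  then have pP: "proper_coloring G P" and nP: "{} \<notin> P"
    by (auto simp: min_td_coloring_def total_dominator_coloring_def proper_coloring_def
        partition_on_def)
  have "\<exists>B\<in>P. B \<noteq> {} \<and> adjacent_to_all G v B" if "v \<in> pverts G" for v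
    using P that nP unfolding min_td_coloring_def total_dominator_coloring_def by metis
  \<comment> \<open>With \<open>A = {}\<close> every class of \<open>P\<close> is lifted, giving at
    most two extra colors for any \<open>G\<close> considered here.\<close>
  then obtain Q where Q: "total_dominator_coloring (mycielskian G) Q" "card Q \<le> card (P - {{}}) + 2"
    using mycielskian_coloring[OF assms(1,2) pP, of "{}"] by blast
  have upper: "td_chromatic_number (mycielskian G) \<le> td_chromatic_number G + 2"
    using td_chromatic_number_le[OF Q(1)] Q(2) P nP by (simp add: min_td_coloring_def)
  show ?thesis
  proof
    assume "class_2 G"
    obtain Q' where "min_td_coloring (mycielskian G) Q'"
      using min_td_coloring_exists Q(1) by blast
    then have "\<not> td_chromatic_number (mycielskian G) \<le> td_chromatic_number G + 1"
      using class_1_if_mycielskian_coloring[OF assms(1), of Q'] \<open>class_2 G\<close>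
      by (auto simp: class_2_def min_td_coloring_def)
    with upper show "td_chromatic_number (mycielskian G) = td_chromatic_number G + 2"
      by simp
  next
    assume eq: "td_chromatic_number (mycielskian G) = td_chromatic_number G + 2"
    show "class_2 G"
      unfolding class_2_def
    proof
      assume "class_1 G"
      then obtain P A where P: "min_td_coloring G P" "A \<in> P"
        and dom: "\<And>v. v \<in> pverts G \<Longrightarrow> \<exists>B\<in>P. B \<noteq> A \<and> adjacent_to_all G v B"
        by (rule class_1E) blast
      have pP: "proper_coloring G P"
        using P by (simp add: min_td_coloring_def total_dominator_coloring_def)
      obtain Q where Q: "total_dominator_coloring (mycielskian G) Q" "card Q \<le> card (P - {A}) + 2"
        using mycielskian_coloring[OF assms(1,2) pP _ dom] P(2) by blast
      \<comment> \<open>Merging \<open>A\<close> with the apex saves one color, so the Mycielskian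
        needs at most one more than \<open>G\<close>.\<close>
      have "card (P - {A}) < card P"
        using proper_coloring_finite[OF assms(1) pP] P(2) by (rule card_Diff1_less)
      then show False
        using td_chromatic_number_le[OF Q(1)] Q(2) eq P(1) by (simp add: min_td_coloring_def)
    qed
  qed
qed

end
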